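(* Let $\bm Z=(\bm X_i,f(\bm X_i))_{i=1}^n$ with $\bm X_1,\dots,\bm X_n$ independent and identically distributed according to $\rho$ on $\Omega$. Let $\Xi=\Xi(h,C_1,C_2)\subseteq(\Omega\times Y)^n$ be the set of admissible samples (defined in the context), let $\gamma=1-\mathbb P\{\bm Z\in\Xi\}$, and let $$m=\mathbb E\{\mathrm{CV}(\bm Z,h)\mid\bm Z\in\Xi\}$$ be the expected value of the cross-validation score restricted to $\Xi$. Then for every $\varepsilon>2\gamma nC_1C_2+\gamma C_1^2$, \begin{align*} \mathbb P\left\{|\mathrm{CV}(\bm Z,h)-m|>\varepsilon\right\} &\le2\gamma+2\exp\left(-\left(\frac{\sqrt2\,\varepsilon}{C_1(C_1/\sqrt n+2\sqrt n\,C_2)}-\sqrt{2n}\,\gamma\right)^2\right)\\ &\le2\gamma+2\exp\left(-\left(\frac{\varepsilon}{3\sqrt n\,C_1^2}-\sqrt{2n}\,\gamma\right)^2\right), \end{align*} where the second inequality holds for $n\ge5$.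
   Context: $(\Omega,\rho)$ is a probability space, $Y\subseteq\mathbb C$ is a set of values with absolute value $|\cdot|$, and $f\colon\Omega\to Y$ is the function to be approximated. A reconstruction method $R_h$ assigns to a finite list of samples in $\Omega\times Y$ (here lists of length $n-1$) a function $\Omega\to Y$; $h$ is a label for the method/parameter. $\|g\|_\infty=\sup_{\bm x\in\Omega}|g(\bm x)|$. All functions and sets are tacitly assumed measurable where needed. For $\bm z=(z_1,\dots,z_n)\in(\Omega\times Y)^n$ with nodes $\bm x_1,\dots,\bm x_n$, put $\bm z_{-i}=(z_1,\dots,z_{i-1},z_{i+1},\dots,z_n)$. Leave-one-out cross-validation score: $\mathrm{CV}(\bm z,h)=\frac1n\sum_{i=1}^n|R_h(\bm z_{-i})(\bm x_i)-f(\bm x_i)|^2$. Conditional expectation given an event $B$: $\mathbb E\{X\mid B\}=\mathbb E\{\mathbf 1_BX\}/\mathbb P\{B\}$; it is assumed that $\mathbb P\{\bm Z\in\Xi\}>0$. Set of admissible samples: for constants $C_1,C_2>0$ with $C_2\le 2C_1$, $\Xi=\Xi(h,C_1,C_2)\subseteq(\Omega\times Y)^n$ denotes a set of samples for which (i) $\|R_h(\bm z_{-i})-f\|_\infty<C_1$ for all $\bm z\in\Xi$ and $1\le i\le n$; (ii) for every $\bm x\in\Omega$ and $1\le i\le n$ the map $\bm z_{-i}\mapsto R_h(\bm z_{-i})(\bm x)$ is $C_2\mathbf 1$-bounded on $\Xi$, i.e. $|R_h(\bm z_{-i})(\bm x)-R_h(\bm z'_{-i})(\bm x)|\le C_2\cdot\#\{j\ne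 i: z_j\ne z_j'\}$ for all $\bm z,\bm z'\in\Xi$.
   Formalization: The comparison of the two right-hand sides fails for ε near the threshold when γ>0; it is stated for n≥5 only when √(2n)γ ≤ ε/(3√n C₁²). Both bounds on the probability itself are stated for all admissible ε (the second for n≥5). *)

theory Defs
  imports "HOL-Probability.Probability"
begin

text \<open>
  A tuple in \<open>A\<^sup>n\<close> is an extensional function in \<open>{..<n} \<rightarrow>\<^sub>E A\<close>, with indices starting at 0.
  A reconstruction method takes a finite list of samples (node, value); its first argument of
  type \<open>'h\<close> is the label \<open>h\<close>.
\<close>

type_synonym 'a sample = "'a \<times> complex"

type_synonym ('h, 'a) reconstruction = "'h \<Rightarrow> 'a sample list \<Rightarrow> 'a \<Rightarrow> complex"

definition leave_out :: "nat \<Rightarrow> (nat \<Rightarrow> 'b) \<Rightarrow> nat \<Rightarrow> 'b list" where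
  "leave_out n z i = map z ([0..<i] @ [Suc i..<n])"

definition cv_score ::
  "('h, 'a) reconstruction \<Rightarrow> ('a \<Rightarrow> complex) \<Rightarrow> nat \<Rightarrow> (nat \<Rightarrow> 'a sample) \<Rightarrow> 'h \<Rightarrow> real" where
  "cv_score R f n z h =
     1 / real n * (\<Sum>i<n. (cmod (R h (leave_out n z i) (fst (z i)) - f (fst (z i))))\<^sup>2)"

text \<open>The supremum is taken in the extended reals, so it is \<open>\<infinity>\<close> for unbounded functions.\<close>

definition sup_norm_on :: "'a set \<Rightarrow> ('a \<Rightarrow> complex) \<Rightarrow> ereal" where
  "sup_norm_on S g = (SUP x\<in>S. ereal (cmod (g x)))"

text \<open>
  The two conditions do not determine a unique set of samples: any \<open>\<Xi>\<close> satisfying them is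
  admissible.
\<close>

definition admissible_samples ::
  "'a set \<Rightarrow> complex set \<Rightarrow> ('h, 'a) reconstruction \<Rightarrow> ('a \<Rightarrow> complex) \<Rightarrow> nat \<Rightarrow> 'h \<Rightarrow> real \<Rightarrow> real
    \<Rightarrow> (nat \<Rightarrow> 'a sample) set \<Rightarrow> bool" where
  "admissible_samples \<Omega> Y R f n h C1 C2 \<Xi> \<longleftrightarrow>
     \<Xi> \<subseteq> {..<n} \<rightarrow>\<^sub>E \<Omega> \<times> Y \<and>
     (\<forall>z\<in>\<Xi>. \<forall>i<n. sup_norm_on \<Omega> (\<lambda>x. R h (leave_out n z i) x - f x) < ereal C1) \<and>
     (\<forall>x\<in>\<Omega>. \<forall>i<n. \<forall>z\<in>\<Xi>. \<forall>z'\<in>\<Xi>.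
        cmod (R h (leave_out n z i) x - R h (leave_out n z' i) x)
          \<le> C2 * real (card {j. j < n \<and> j \<noteq> i \<and> z j \<noteq> z' j}))"

definition cond_exp_event :: "'w measure \<Rightarrow> ('w \<Rightarrow> real) \<Rightarrow> 'w set \<Rightarrow> real" where
  "cond_exp_event P X B = (LINT \<omega>|P. indicator B \<omega> * X \<omega>) / measure P B"

definition samples :: "nat \<Rightarrow> (nat \<Rightarrow> 'w \<Rightarrow> 'a) \<Rightarrow> ('a \<Rightarrow> complex) \<Rightarrow> 'w \<Rightarrow> nat \<Rightarrow> 'a sample" where
  "samples n X f \<omega> = (\<lambda>i\<in>{..<n}. (X i \<omega>, f (X i \<omega>)))"

end

theory Submission
  imports Defs
begin

text \<open>
  On \<open>\<Xi>\<close> the score has bounded differences with constant \<open>c = C1\<^sup>2 / n + 2 C1 C2\<close> per coordinate.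
  Extend it from \<open>\<Xi>\<close> to a measurable \<open>u\<close> with almost everywhere bounded differences, so that
  McDiarmid's argument bounds the expectation of \<open>cosh (l (u - m))\<close> by
  \<open>exp (l\<^sup>2 n c\<^sup>2 / 8) cosh (l \<delta>)\<close>, where \<open>\<delta>\<close> is the mean of \<open>u\<close> minus \<open>m\<close>. Since \<open>u - m\<close> has mean \<open>0\<close>
  on \<open>\<Xi>\<close>, its integral over the complement, which has probability \<open>\<gamma>\<close>, is \<open>\<delta>\<close>; by Jensen the
  complement accounts for at least \<open>\<gamma> cosh (l \<delta> / \<gamma>)\<close> of that expectation. Subtracting this share
  removes the effect of the shift \<open>\<delta>\<close>, and the bound \<open>2 \<gamma> + 2 exp (- 2 \<epsilon>\<^sup>2 / (n c\<^sup>2))\<close> results for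
  every \<open>\<epsilon> \<ge> 0\<close>. Both claimed bounds are weaker for the given range of \<open>\<epsilon>\<close>; this stronger bound is
  needed because the second one does not follow from the first when
  \<open>\<epsilon> / (3 \<surd>n C1\<^sup>2) < \<surd>(2n) \<gamma>\<close>.
\<close>

section \<open>Measurable extension of functions with bounded differences\<close>

lemma measurable_fun_upd_pair:
  assumes "i \<in> J"
  shows "(\<lambda>(z, t). z(i := t)) \<in> PiM J M \<Otimes>\<^sub>M M i \<rightarrow>\<^sub>M PiM J M"
  using measurable_add_dim[of i J M] assms by (simp add: insert_absorb)

text \<open>An essential infimum: a sequence of majorants whose means tend to the infimum
  \<open>v\<close> of all means has a pointwise infimum with mean exactly \<open>v\<close>, and no
  other majorant can undercut it on a non-null set.\<close>

lemma (in prob_space) minimal_measurable_majorant: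
  fixes g :: "'a \<Rightarrow> real" and B :: real
  defines "\<G> \<equiv> {G \<in> borel_measurable M. \<forall>z\<in>space M. g z \<le> G z \<and> \<bar>G z\<bar> \<le> B}"
  assumes "\<G> \<noteq> {}"
  obtains u where "u \<in> \<G>" "\<And>G. G \<in> \<G> \<Longrightarrow> AE z in M. u z \<le> G z"
proof -
  have int: "integrable M G" if "G \<in> \<G>" for G
    using that by (intro integrable_const_bound[where B=B]) (auto simp: \<G>_def)
  have lower: "- B \<le> expectation G" if "G \<in> \<G>" for G
  proof -
    have "expectation (\<lambda>_. - B) \<le> expectation G"
      using that int[OF that] by (intro integral_mono) (force simp: \<G>_def abs_le_iff)+
    then show ?thesis by (simp add: prob_space)
  qed
  have bdd: "bdd_below (expectation ` \<G>)"
    using lower by (auto intro!: bdd_belowI)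
  define v where "v = (INF G\<in>\<G>. expectation G)"
  have v_le: "v \<le> expectation G" if "G \<in> \<G>" for G
    unfolding v_def by (rule cINF_lower[OF bdd that])
  have "\<exists>G\<in>\<G>. expectation G < v + 1 / real (Suc k)" for k
  proof -
    have "v < v + 1 / real (Suc k)" by simp
    then show ?thesis
      unfolding v_def using cINF_less_iff[OF \<open>\<G> \<noteq> {}\<close> bdd] by blast
  qed
  then obtain G where G: "\<And>k. G k \<in> \<G>" "\<And>k. expectation (G k) < v + 1 / real (Suc k)"
    by metis
  define u where "u z = (INF k. G k z)" for z
  have bddG: "bdd_below (range (\<lambda>k. G k z))" if "z \<in> space M" for z
    using G(1) that by (intro bdd_belowI[where m="g z"]) (auto simp: \<G>_def)
  have u_le: "u z \<le> G k z" if "z \<in> space M" for z k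
    unfolding u_def using bddG[OF that] by (rule cINF_lower) simp
  have ge_u: "g z \<le> u z" "- B \<le> u z" if "z \<in> space M" for z
    unfolding u_def using G(1) that
    by (auto intro!: cINF_greatest simp: \<G>_def abs_le_iff minus_le_iff)
  have "u \<in> borel_measurable M"
    unfolding u_def using G(1) bddG by (intro borel_measurable_cINF_real) (auto simp: \<G>_def)
  moreover have "\<bar>u z\<bar> \<le> B" if "z \<in> space M" for z
    using u_le[OF that, of 0] ge_u[OF that] G(1)[of 0] that
    by (force simp: \<G>_def abs_le_iff)
  ultimately have u: "u \<in> \<G>"
    using ge_u by (auto simp: \<G>_def)
  have "expectation u \<le> v + 1 / real (Suc k)" for k
  proof -
    have "expectation u \<le> expectation (G k)"
      using u_le by (intro integral_mono int u G)
    then show ?thesis using G(2)[of k] by simp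
  qed
  then have "expectation u \<le> v"
    by (metis LIMSEQ_inverse_real_of_nat_add LIMSEQ_le_const inverse_eq_divide)
  then have u_v: "expectation u = v"
    using v_le[OF u] by simp
  show ?thesis
  proof (rule that[OF u])
    fix H assume H: "H \<in> \<G>"
    \<comment> \<open>The minimum is again a competitor, so its mean cannot drop below
      \<open>v\<close>; being below \<open>u\<close> with the same mean, it equals \<open>u\<close>
      almost everywhere.\<close>
    have m: "(\<lambda>z. min (u z) (H z)) \<in> \<G>"
      using u H by (auto simp: \<G>_def min_def)
    have "expectation (\<lambda>z. min (u z) (H z)) \<le> expectation u"
      by (intro integral_mono int m u) auto
    then have "expectation (\<lambda>z. min (u z) (H z)) = expectation u"
      using v_le[OF m] u_v by simp
    then have "AE z in M. min (u z) (H z) = u z"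
      by (intro integral_ineq_eq_0_then_AE int m u) auto
    then show "AE z in M. u z \<le> H z"
      by eventually_elim auto
  qed
qed

text \<open>
  The usual extension \<open>g z = inf {F y + d z y | y \<in> \<Xi>}\<close> need not be measurable. A minimal measurable
  majorant \<open>u\<close> of \<open>g\<close> inherits the bounded differences of \<open>g\<close>, almost everywhere: otherwise \<open>u\<close> could
  be lowered to a rational \<open>q\<close> where \<open>u (z(i := t)) + c i < q\<close> for a non-null set of \<open>t\<close>.
\<close>

lemma (in product_prob_space) AE_bounded_differences_extension:
  fixes F :: "('i \<Rightarrow> 'a) \<Rightarrow> real" and c :: "'i \<Rightarrow> real"
  assumes "finite J" and \<Xi>: "\<Xi> \<in> sets (PiM J M)" "\<Xi> \<noteq> {}"
    and F [measurable]: "F \<in> borel_measurable (PiM J M)"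
    and c: "\<And>i. i \<in> J \<Longrightarrow> 0 \<le> c i"
    and diff: "\<And>z y. z \<in> \<Xi> \<Longrightarrow> y \<in> \<Xi> \<Longrightarrow> F z \<le> F y + sum c {j\<in>J. z j \<noteq> y j}"
  obtains u B where "u \<in> borel_measurable (PiM J M)"
    and "\<And>z. z \<in> space (PiM J M) \<Longrightarrow> \<bar>u z\<bar> \<le> B"
    and "\<And>z. z \<in> \<Xi> \<Longrightarrow> u z = F z"
    and "\<And>i. i \<in> J \<Longrightarrow> AE z in PiM J M. AE t in M i. u z \<le> u (z(i := t)) + c i"
proof -
  interpret N: prob_space "PiM J M"
    by (rule prob_space_PiM) (rule prob_space)
  obtain y0 where y0: "y0 \<in> \<Xi>" using \<Xi> by blast
  \<comment> \<open>A weighted Hamming distance; \<open>diff\<close> says that \<open>F\<close> is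
    1-Lipschitz for it on \<open>\<Xi>\<close>.\<close>
  define d where "d z y = sum c {j\<in>J. z j \<noteq> y j}" for z y :: "'i \<Rightarrow> 'a"
  define D where "D = sum c J"
  have d: "0 \<le> d z y" "d z y \<le> D" for z y
    unfolding d_def D_def using c \<open>finite J\<close> by (auto intro!: sum_nonneg sum_mono2)
  have d_sym: "d z y = d y z" for z y
    unfolding d_def by (simp add: eq_commute)
  have d_upd: "d z y \<le> d (z(i := t)) y + c i" if "i \<in> J" for z y i t
  proof -
    have "d z y \<le> sum c (insert i {j\<in>J. (z(i := t)) j \<noteq> y j})"
      unfolding d_def using c \<open>finite J\<close> that by (intro sum_mono2) auto
    also have "\<dots> \<le> d (z(i := t)) y + c i"
      unfolding d_def using c[OF that] \<open>finite J\<close> by (auto simp: sum.insert_if)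
    finally show ?thesis .
  qed
  have F_y0: "\<bar>F z - F y0\<bar> \<le> D" if "z \<in> \<Xi>" for z
    using diff[OF that y0] diff[OF y0 that] d[of z y0] d_sym[of z y0] by (simp add: d_def)
  define B where "B = \<bar>F y0\<bar> + D"
  define g where "g z = (INF y\<in>\<Xi>. F y + d z y)" for z
  have g_lower: "F y0 - D \<le> F y + d z y" if "y \<in> \<Xi>" for y z
    using F_y0[OF that] d[of z y] by simp
  then have bdd: "bdd_below ((\<lambda>y. F y + d z y) ` \<Xi>)" for z
    by (auto intro!: bdd_belowI)
  have g_ge: "F y0 - D \<le> g z" for z
    unfolding g_def using \<Xi> g_lower by (intro cINF_greatest) auto
  have g_le: "g z \<le> F y0 + D" for z
    using cINF_lower[OF bdd y0, of z] d[of z y0] unfolding g_def by simp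
  have g_\<Xi>: "g z = F z" if "z \<in> \<Xi>" for z
  proof (rule antisym)
    show "g z \<le> F z"
      using cINF_lower[OF bdd that, of z] unfolding g_def by (simp add: d_def)
    show "F z \<le> g z"
      unfolding g_def using \<Xi> diff[OF that] by (intro cINF_greatest) (auto simp: d_def)
  qed
  have g_upd: "g z \<le> g (z(i := t)) + c i" if "i \<in> J" for z i t
  proof -
    have "g z - c i \<le> F y + d (z(i := t)) y" if "y \<in> \<Xi>" for y
      using cINF_lower[OF bdd that, of z] d_upd[OF \<open>i \<in> J\<close>, of z y t] by (simp add: g_def)
    then have "g z - c i \<le> g (z(i := t))"
      unfolding g_def[of "z(i := t)"] using \<Xi> by (intro cINF_greatest) auto
    then show ?thesis by simp
  qed
  define \<G> where
    "\<G> = {G \<in> borel_measurable (PiM J M). \<forall>z\<in>space (PiM J M). g z \<le> G z \<and> \<bar>G z\<bar> \<le> B}"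
  have "(\<lambda>_. F y0 + D) \<in> \<G>"
    using g_le d[of y0 y0] by (auto simp: \<G>_def B_def)
  then obtain u0 where u0: "u0 \<in> \<G>" "\<And>G. G \<in> \<G> \<Longrightarrow> AE z in PiM J M. u0 z \<le> G z"
    using N.minimal_measurable_majorant[of g B] unfolding \<G>_def[symmetric] by blast
  \<comment> \<open>Resetting \<open>u0\<close> to \<open>F\<close> on \<open>\<Xi>\<close> gives
    exact agreement there. Since \<open>F = g\<close> on \<open>\<Xi>\<close>, the result lies
    between \<open>g\<close> and \<open>u0\<close>, so it stays a majorant and stays
    minimal.\<close>
  define u where "u z = (if z \<in> \<Xi> then F z else u0 z)" for z
  have u_le_u0: "u z \<le> u0 z" if "z \<in> space (PiM J M)" for z
    using u0(1) g_\<Xi>[of z] that by (auto simp: \<G>_def u_def)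
  have u: "u \<in> \<G>"
    using u0(1) \<Xi>(1) g_\<Xi> F_y0 unfolding u_def \<G>_def B_def
    by (fastforce intro!: measurable_If_set)
  have minimal: "AE z in PiM J M. u z \<le> G z" if "G \<in> \<G>" for G
    using u0(2)[OF that] AE_space by eventually_elim (use u_le_u0 in force)
  have u_meas [measurable]: "u \<in> borel_measurable (PiM J M)"
    using u by (simp add: \<G>_def)
  show ?thesis
  proof (rule that)
    show "u \<in> borel_measurable (PiM J M)" by fact
    show "\<bar>u z\<bar> \<le> B" if "z \<in> space (PiM J M)" for z
      using u that by (simp add: \<G>_def)
    show "u z = F z" if "z \<in> \<Xi>" for z
      using that by (simp add: u_def)
    fix i assume i: "i \<in> J"
    note [measurable] = measurable_fun_upd_pair[OF i, of M]
    have space_upd: "z(i := t) \<in> space (PiM J M)"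
      if "z \<in> space (PiM J M)" "t \<in> space (M i)" for z t
      using that i by (auto simp: space_PiM PiE_iff extensional_def)
    have upd [measurable]: "(\<lambda>x. u ((fst x)(i := snd x))) \<in> borel_measurable (PiM J M \<Otimes>\<^sub>M M i)"
      using measurable_compose[OF measurable_fun_upd_pair[OF i] u_meas]
      by (simp add: split_beta')
    have upd_z: "(\<lambda>t. u (z(i := t))) \<in> borel_measurable (M i)" if "z \<in> space (PiM J M)" for z
      using measurable_compose_Pair1[OF that upd] by simp
    have u_q: "AE z in PiM J M. (AE t in M i. q \<le> u (z(i := t)) + c i) \<or> u z \<le> q" for q :: real
    proof -
      define e where "e z = emeasure (M i) {t\<in>space (M i). u (z(i := t)) + c i < q}" for z
      have [measurable]: "e \<in> borel_measurable (PiM J M)"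
        unfolding e_def
        by (measurable)
      define G where "G z = (if 0 < e z then min (u z) q else u z)" for z
      \<comment> \<open>A set of positive measure is nonempty, so a single \<open>t\<close> in it
        transfers the differences of \<open>g\<close> to \<open>z\<close>. This keeps the lowered
        function \<open>G\<close> above \<open>g\<close>.\<close>
      have "g z \<le> q" if z: "z \<in> space (PiM J M)" and "0 < e z" for z
      proof -
        have "{t\<in>space (M i). u (z(i := t)) + c i < q} \<noteq> {}"
          using \<open>0 < e z\<close> unfolding e_def by (metis emeasure_empty less_irrefl)
        then obtain t where t: "t \<in> space (M i)" "u (z(i := t)) + c i < q" by blast
        have "g z \<le> g (z(i := t)) + c i" by (rule g_upd[OF i])
        also have "\<dots> \<le> u (z(i := t)) + c i"
          using u space_upd[OF z t(1)] by (simp add: \<G>_def)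
        finally show ?thesis using t(2) by simp
      qed
      moreover have "- B \<le> g z" for z
        using g_ge[of z] by (simp add: B_def)
      ultimately have "G \<in> \<G>"
        using u unfolding \<G>_def G_def
        by (simp add: min_def) (smt (verit))
      then have "AE z in PiM J M. u z \<le> G z" by (rule minimal)
      then show ?thesis
        using AE_space
      proof eventually_elim
        case (elim z)
        show ?case
        proof (cases "0 < e z")
          case True
          then show ?thesis using elim by (simp add: G_def)
        next
          case False
          have "AE t in M i. \<not> u (z(i := t)) + c i < q"
            using False upd_z[OF elim(2)]
            by (subst AE_iff_measurable[OF _ refl]) (auto simp: e_def)
          then show ?thesis by (auto simp: not_less)
        qed
      qed
    qed
    \<comment> \<open>Rational levels suffice: countably many null sets combine into one, and any
      violation would leave room for a rational between the two sides.\<close>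
    then have "AE z in PiM J M. \<forall>q::rat.
        (AE t in M i. of_rat q \<le> u (z(i := t)) + c i) \<or> u z \<le> of_rat q"
      by (simp add: AE_all_countable)
    then show "AE z in PiM J M. AE t in M i. u z \<le> u (z(i := t)) + c i"
    proof eventually_elim
      case (elim z)
      have "AE t in M i. \<forall>q::rat. of_rat q \<le> u (z(i := t)) + c i \<or> u z \<le> of_rat q"
        unfolding AE_all_countable using elim by (auto elim: eventually_mono)
      then show ?case
      proof eventually_elim
        case (elim t)
        show ?case
        proof (rule ccontr)
          assume "\<not> ?case"
          then obtain q where "u (z(i := t)) + c i < of_rat q" "of_rat q < u z"
            using of_rat_dense by (auto simp: not_le)
          with elim[rule_format, of q] show False by simp
        qed
      qed
    qed
  qed
qed

section \<open>Exponential moments under bounded differences\<close>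

text \<open>Hoeffding's lemma for \<open>l\<close> of either sign; negative \<open>l\<close> reduces
  to positive \<open>l\<close> by passing to \<open>- w\<close> on
  \<open>{- b..- a}\<close>.\<close>

lemma (in prob_space) mgf_le_of_AE_bounded:
  fixes w :: "'a \<Rightarrow> real" and l :: real
  assumes w [measurable]: "w \<in> borel_measurable M" and "AE x in M. w x \<in> {a..b}"
  shows "(\<integral>\<^sup>+x. exp (l * (w x - expectation w)) \<partial>M) \<le> exp (l\<^sup>2 * (b - a)\<^sup>2 / 8)"
proof -
  consider "l > 0" | "l = 0" | "l < 0" by linarith
  then show ?thesis
  proof cases
    case 1
    interpret W: interval_bounded_random_variable M w a b
      using assms by unfold_locales auto
    show ?thesis by (rule W.Hoeffdings_lemma_nn_integral[OF 1])
  next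
    case 2
    then show ?thesis by (simp add: emeasure_space_1)
  next
    case 3
    interpret W: interval_bounded_random_variable M "\<lambda>x. - w x" "- b" "- a"
      using assms by unfold_locales (auto elim: eventually_mono)
    show ?thesis
      using W.Hoeffdings_lemma_nn_integral[of "- l"] 3 by (simp add: algebra_simps power2_commute)
  qed
qed

text \<open>\<open>Inf Q\<close> is the essential supremum of \<open>w\<close>, and \<open>a\<close>
  is that value minus \<open>c\<close>. Just below it, \<open>w\<close> is exceeded on a non-null
  set, and the oscillation bound from such points gives the lower end.\<close>

lemma (in prob_space) AE_range_of_AE_oscillation:
  fixes w :: "'a \<Rightarrow> real"
  assumes bound: "\<And>x. x \<in> space M \<Longrightarrow> \<bar>w x\<bar> \<le> B"
    and osc: "AE t in M. AE s in M. w t \<le> w s + c"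
  obtains a where "AE t in M. w t \<in> {a..a + c}"
proof -
  define Q where "Q = {q. AE t in M. w t \<le> q}"
  have "B \<in> Q" using bound AE_space unfolding Q_def by (auto elim!: eventually_mono simp: abs_le_iff)
  have "- B \<le> q" if "q \<in> Q" for q
  proof -
    have "AE t in M. - B \<le> q"
      using that AE_space unfolding Q_def mem_Collect_eq
      by eventually_elim (use bound in \<open>force simp: abs_le_iff\<close>)
    then show ?thesis by simp
  qed
  then have bdd: "bdd_below Q" by (rule bdd_belowI)
  have upper: "AE t in M. w t \<le> Inf Q"
  proof -
    have "AE t in M. w t \<le> Inf Q + 1 / real (Suc k)" for k
    proof -
      have "Inf Q < Inf Q + 1 / real (Suc k)" by simp
      then obtain q where "q \<in> Q" "q < Inf Q + 1 / real (Suc k)"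
        using cInf_less_iff[OF _ bdd] \<open>B \<in> Q\<close> by blast
      then show ?thesis by (auto simp: Q_def elim!: eventually_mono)
    qed
    then have "AE t in M. \<forall>k. w t \<le> Inf Q + 1 / real (Suc k)"
      by (simp add: AE_all_countable)
    then show ?thesis
      by eventually_elim (metis LIMSEQ_inverse_real_of_nat_add LIMSEQ_le_const inverse_eq_divide)
  qed
  have lower: "AE s in M. Inf Q \<le> w s + c"
  proof -
    have "AE s in M. Inf Q - 1 / real (Suc k) \<le> w s + c" for k
    proof -
      have "Inf Q - 1 / real (Suc k) \<notin> Q"
        using cInf_lower[OF _ bdd, of "Inf Q - 1 / real (Suc k)"] by auto
      then have "\<exists>\<^sub>F t in ae_filter M. \<not> w t \<le> Inf Q - 1 / real (Suc k)"
        by (simp add: Q_def frequently_def)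
      \<comment> \<open>A non-null set meets every set of full measure, which gives one
        \<open>t\<close> with both properties.\<close>
      then have "\<exists>\<^sub>F t in ae_filter M. \<not> w t \<le> Inf Q - 1 / real (Suc k) \<and> (AE s in M. w t \<le> w s + c)"
        using osc by (rule frequently_eventually_frequently)
      then obtain t where "\<not> w t \<le> Inf Q - 1 / real (Suc k)" "AE s in M. w t \<le> w s + c"
        by (auto dest: frequently_ex)
      then show ?thesis by (auto elim!: eventually_mono)
    qed
    then have "AE s in M. \<forall>k. Inf Q - 1 / real (Suc k) \<le> w s + c"
      by (simp add: AE_all_countable)
    then show ?thesis
    proof eventually_elim
      case (elim s)
      then have "Inf Q \<le> (w s + c) + 1 / real (Suc k)" for k
        by (simp add: algebra_simps)
      then show ?case
        by (metis LIMSEQ_inverse_real_of_nat_add LIMSEQ_le_const inverse_eq_divide)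
    qed
  qed
  have "AE t in M. w t \<in> {Inf Q - c..Inf Q - c + c}"
    using upper lower by eventually_elim auto
  then show ?thesis by (rule that)
qed

text \<open>Fubini for null sets: the indicator of a measurable null set covering the exceptions has
  iterated integral 0, so almost every section is null.\<close>

lemma (in product_sigma_finite) AE_PiM_insertD:
  assumes "finite J" "i \<notin> J" and "AE z in PiM (insert i J) M. Q z"
  shows "AE z in PiM J M. AE t in M i. Q (z(i := t))"
proof -
  interpret J: finite_product_sigma_finite M J by standard fact
  interpret sigma_finite_measure "M i" by (rule sigma_finite_measures)
  obtain N where N: "{z\<in>space (PiM (insert i J) M). \<not> Q z} \<subseteq> N"
      "emeasure (PiM (insert i J) M) N = 0" and [measurable]: "N \<in> sets (PiM (insert i J) M)"
    using assms(3) by (auto elim: AE_E)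
  have "(\<integral>\<^sup>+z. (\<integral>\<^sup>+t. indicator N (z(i := t)) \<partial>M i) \<partial>PiM J M) = 0"
    using N by (subst product_nn_integral_insert[OF assms(1,2), symmetric]) simp_all
  moreover have ind: "(\<lambda>z. \<integral>\<^sup>+t. indicator N (z(i := t)) \<partial>M i) \<in> borel_measurable (PiM J M)"
    by measurable
  ultimately have "AE z in PiM J M. (\<integral>\<^sup>+t. indicator N (z(i := t)) \<partial>M i) = 0"
    by (simp add: nn_integral_0_iff_AE)
  then show ?thesis
    using AE_space
  proof eventually_elim
    case (elim z)
    note [measurable] = measurable_component_update[OF elim(2) assms(2)]
    have "AE t in M i. indicator N (z(i := t)) = (0::ennreal)"
      using elim(1) by (subst (asm) nn_integral_0_iff_AE) auto
    then show ?case
      using AE_space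
    proof eventually_elim
      case (elim t)
      have "z(i := t) \<in> space (PiM (insert i J) M)"
        using \<open>z \<in> space (PiM J M)\<close> elim(2) by (auto simp: space_PiM PiE_iff extensional_def)
      then show ?case
        using elim(1) N(1) by (auto simp: indicator_def split: if_splits)
    qed
  qed
qed

text \<open>McDiarmid's argument by induction on the coordinates: \<open>v\<close> averages out
  coordinate \<open>i\<close>, Hoeffding's lemma bounds the fluctuation of \<open>u\<close> around
  \<open>v\<close> by the factor for \<open>c i\<close>, and the induction hypothesis applies to
  \<open>v\<close>.\<close>

lemma (in product_prob_space) mgf_le_of_AE_bounded_differences:
  fixes u :: "('i \<Rightarrow> 'a) \<Rightarrow> real" and c :: "'i \<Rightarrow> real" and l :: real
  assumes "finite J" and "u \<in> borel_measurable (PiM J M)"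
    and "\<And>z. z \<in> space (PiM J M) \<Longrightarrow> \<bar>u z\<bar> \<le> B"
    and "\<And>i. i \<in> J \<Longrightarrow> AE z in PiM J M. AE t in M i. u z \<le> u (z(i := t)) + c i"
  shows "(\<integral>\<^sup>+z. exp (l * (u z - (\<integral>y. u y \<partial>PiM J M))) \<partial>PiM J M)
          \<le> exp (l\<^sup>2 * (\<Sum>i\<in>J. (c i)\<^sup>2) / 8)"
  using assms
proof (induction J arbitrary: u rule: finite_induct)
  case empty
  then show ?case by (simp add: PiM_empty lebesgue_integral_count_space_finite nn_integral_count_space_finite)
next
  case (insert i J)
  interpret N: prob_space "PiM J M"
    by (rule prob_space_PiM) (rule prob_space)
  interpret K: prob_space "PiM (insert i J) M"
    by (rule prob_space_PiM) (rule prob_space)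
  note [measurable] = insert.prems(1)
  have upd_space: "z(i := t) \<in> space (PiM (insert i J) M)"
    if "z \<in> space (PiM J M)" "t \<in> space (M i)" for z t
    using that by (auto simp: space_PiM PiE_iff extensional_def)
  have upd_bound: "\<bar>u (z(i := t))\<bar> \<le> B"
    if "z \<in> space (PiM J M)" "t \<in> space (M i)" for z t
    by (intro insert.prems upd_space that)
  have upd_meas [measurable]: "(\<lambda>t. u (z(i := t))) \<in> borel_measurable (M i)"
    if "z \<in> space (PiM J M)" for z
    using measurable_compose[OF measurable_component_update[OF that insert.hyps(2)] insert.prems(1)] .
  have upd_int: "integrable (M i) (\<lambda>t. u (z(i := t)))" if "z \<in> space (PiM J M)" for z
    using that upd_bound by (intro M.integrable_const_bound[where B=B] upd_meas) auto
  define v where "v z = (\<integral>t. u (z(i := t)) \<partial>M i)" for z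
  have v_meas [measurable]: "v \<in> borel_measurable (PiM J M)"
    unfolding v_def by measurable
  have v_bound: "\<bar>v z\<bar> \<le> B" if "z \<in> space (PiM J M)" for z
  proof -
    have "\<bar>v z\<bar> \<le> (\<integral>t. \<bar>u (z(i := t))\<bar> \<partial>M i)"
      unfolding v_def by (rule integral_abs_bound)
    also have "\<dots> \<le> (\<integral>t. B \<partial>M i)"
      using that upd_bound upd_int[OF that] by (intro integral_mono) auto
    finally show ?thesis by (simp add: M.prob_space)
  qed
  have v_diff: "AE z in PiM J M. AE s in M j. v z \<le> v (z(j := s)) + c j" if j: "j \<in> J" for j
  proof -
    interpret P: pair_sigma_finite "M i" "M j"
      by (intro pair_sigma_finite.intro sigma_finite_measures)
    have "j \<noteq> i" using j insert.hyps by auto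
    have "AE z in PiM (insert i J) M. AE s in M j. u z \<le> u (z(j := s)) + c j"
      using j by (intro insert.prems) auto
    from AE_PiM_insertD[OF insert.hyps this] AE_space
    show ?thesis
    proof eventually_elim
      case (elim z)
      have [measurable]: "(\<lambda>x. z(i := fst x)) \<in> M i \<Otimes>\<^sub>M M j \<rightarrow>\<^sub>M PiM (insert i J) M"
        by (rule measurable_compose[OF measurable_fst])
           (rule measurable_component_update[OF elim(2) insert.hyps(2)])
      have "(\<lambda>x. (z(i := fst x), snd x)) \<in> M i \<Otimes>\<^sub>M M j \<rightarrow>\<^sub>M PiM (insert i J) M \<Otimes>\<^sub>M M j"
        by measurable
      from measurable_compose[OF this measurable_fun_upd_pair] j
      have [measurable]: "(\<lambda>x. z(i := fst x, j := snd x)) \<in> M i \<Otimes>\<^sub>M M j \<rightarrow>\<^sub>M PiM (insert i J) M"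
        by simp
      \<comment> \<open>The hypothesis has the quantifiers in the order \<open>t\<close>,
        \<open>s\<close>. Integrating over \<open>t\<close> for fixed \<open>s\<close> requires the
        reverse order, which joint measurability permits.\<close>
      have "AE s in M j. AE t in M i. u (z(i := t)) \<le> u (z(i := t, j := s)) + c j"
        using elim(1) by (subst P.AE_commute[symmetric]) measurable
      then show ?case
        using AE_space
      proof eventually_elim
        case (elim s)
        have z: "z \<in> space (PiM J M)" by fact
        then have zs: "z(j := s) \<in> space (PiM J M)"
          using elim(2) j by (auto simp: space_PiM PiE_iff extensional_def)
        have "v z \<le> (\<integral>t. u (z(j := s, i := t)) + c j \<partial>M i)"
          unfolding v_def using elim(1) upd_int[OF z] upd_int[OF zs] \<open>j \<noteq> i\<close>
          by (intro integral_mono_AE) (auto simp: fun_upd_twist[OF \<open>j \<noteq> i\<close>])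
        also have "\<dots> = v (z(j := s)) + c j"
          using upd_int[OF zs] by (simp add: v_def M.prob_space)
        finally show ?case .
      qed
    qed
  qed
  let ?\<mu> = "\<integral>y. u y \<partial>PiM (insert i J) M"
  have mean: "?\<mu> = (\<integral>z. v z \<partial>PiM J M)"
    unfolding v_def using insert.hyps insert.prems
    by (intro product_integral_insert K.integrable_const_bound[where B=B]) auto
  \<comment> \<open>Of two updates at \<open>i\<close> only the last survives, so the hypothesis for
    \<open>i\<close> becomes an oscillation bound on the section in coordinate
    \<open>i\<close>.\<close>
  have "AE z in PiM J M. AE t in M i. AE s in M i. u (z(i := t)) \<le> u (z(i := s)) + c i"
    using AE_PiM_insertD[OF insert.hyps insert.prems(3)[OF insertI1]] by (simp only: fun_upd_upd)
  then have inner: "AE z in PiM J M. (\<integral>\<^sup>+t. exp (l * (u (z(i := t)) - ?\<mu>)) \<partial>M i)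
      \<le> exp (l\<^sup>2 * (c i)\<^sup>2 / 8) * ennreal (exp (l * (v z - ?\<mu>)))"
    using AE_space
  proof eventually_elim
    case (elim z)
    obtain a where a: "AE t in M i. u (z(i := t)) \<in> {a..a + c i}"
      using M.AE_range_of_AE_oscillation[OF upd_bound[OF elim(2)] elim(1)] by blast
    have "(\<integral>\<^sup>+t. exp (l * (u (z(i := t)) - ?\<mu>)) \<partial>M i)
        = (\<integral>\<^sup>+t. ennreal (exp (l * (u (z(i := t)) - v z))) * exp (l * (v z - ?\<mu>)) \<partial>M i)"
      by (intro nn_integral_cong) (simp add: ennreal_mult' [symmetric] exp_add[symmetric] algebra_simps)
    also have "\<dots> = (\<integral>\<^sup>+t. ennreal (exp (l * (u (z(i := t)) - v z))) \<partial>M i) * exp (l * (v z - ?\<mu>))"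
      using upd_meas[OF elim(2)] by (intro nn_integral_multc) simp
    also have "\<dots> \<le> exp (l\<^sup>2 * (c i)\<^sup>2 / 8) * ennreal (exp (l * (v z - ?\<mu>)))"
      using M.mgf_le_of_AE_bounded[OF upd_meas[OF elim(2)] a, of l]
      by (intro mult_right_mono) (auto simp: v_def)
    finally show ?case .
  qed
  have "(\<integral>\<^sup>+z. exp (l * (u z - ?\<mu>)) \<partial>PiM (insert i J) M)
      = (\<integral>\<^sup>+z. (\<integral>\<^sup>+t. exp (l * (u (z(i := t)) - ?\<mu>)) \<partial>M i) \<partial>PiM J M)"
    using insert.hyps by (intro product_nn_integral_insert) auto
  also have "\<dots> \<le> (\<integral>\<^sup>+z. exp (l\<^sup>2 * (c i)\<^sup>2 / 8) * ennreal (exp (l * (v z - ?\<mu>))) \<partial>PiM J M)"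
    by (rule nn_integral_mono_AE) (rule inner)
  also have "\<dots> = exp (l\<^sup>2 * (c i)\<^sup>2 / 8) * (\<integral>\<^sup>+z. ennreal (exp (l * (v z - ?\<mu>))) \<partial>PiM J M)"
    by (intro nn_integral_cmult) measurable
  also have "\<dots> \<le> exp (l\<^sup>2 * (c i)\<^sup>2 / 8) * ennreal (exp (l\<^sup>2 * (\<Sum>i\<in>J. (c i)\<^sup>2) / 8))"
    unfolding mean by (intro mult_left_mono insert.IH v_meas v_bound v_diff) auto
  also have "\<dots> = exp (l\<^sup>2 * (\<Sum>i\<in>insert i J. (c i)\<^sup>2) / 8)"
    using insert.hyps by (simp add: ennreal_mult'[symmetric] exp_add[symmetric] algebra_simps add_divide_distrib)
  finally show ?case .
qed

section \<open>Inequalities for hyperbolic functions\<close>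

text \<open>Both sides vanish at \<open>v = 0\<close>, and the derivative of their difference is
  \<open>k * (cosh (k * x) - cosh (2 * x))\<close>, which is nonnegative because
  \<open>2 \<le> k\<close>.\<close>

lemma sinh_double_le_sinh_mult:
  fixes k v :: real
  assumes "2 \<le> k" "0 \<le> v"
  shows "k * (sinh v * cosh v) \<le> sinh (k * v)"
proof -
  define \<phi> where "\<phi> x = sinh (k * x) - k / 2 * sinh (2 * x)" for x :: real
  have "\<phi> 0 \<le> \<phi> v"
  proof (rule DERIV_nonneg_imp_nondecreasing[OF \<open>0 \<le> v\<close>])
    fix x :: real assume "0 \<le> x"
    have "(\<phi> has_real_derivative k * (cosh (k * x) - cosh (2 * x))) (at x)"
      unfolding \<phi>_def by (auto intro!: derivative_eq_intros simp: algebra_simps)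
    moreover have "cosh (2 * x) \<le> cosh (k * x)"
      using \<open>0 \<le> x\<close> \<open>2 \<le> k\<close> by (subst cosh_real_nonneg_le_iff) (auto intro: mult_right_mono)
    ultimately show "\<exists>y. (\<phi> has_real_derivative y) (at x) \<and> 0 \<le> y"
      using \<open>2 \<le> k\<close> by force
  qed
  then show ?thesis by (simp add: \<phi>_def sinh_double)
qed

text \<open>Half-angle formulas with \<open>v = \<bar>w\<bar> / 2\<close> reduce this to
  \<open>k * (sinh v)\<^sup>2 \<le> sinh (k * v)\<close>.\<close>

lemma cosh_minus_one_square_le:
  fixes k w :: real
  assumes "2 \<le> k"
  shows "(k * (cosh w - 1))\<^sup>2 \<le> 2 * cosh (k * w)"
proof -
  define v where "v = \<bar>w\<bar> / 2"
  have "0 \<le> v" by (simp add: v_def)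
  have w: "cosh w = cosh (2 * v)" "cosh (k * w) = cosh (2 * (k * v))"
    by (auto simp: v_def abs_if)
  have sinh_v: "0 \<le> sinh v" using \<open>0 \<le> v\<close> by simp
  have "k * (sinh v)\<^sup>2 \<le> k * (sinh v * cosh v)"
    using sinh_v sinh_le_cosh_real[of v] \<open>2 \<le> k\<close>
    by (simp add: power2_eq_square mult_left_mono)
  also have "\<dots> \<le> sinh (k * v)"
    by (rule sinh_double_le_sinh_mult) fact+
  finally have "(k * (sinh v)\<^sup>2)\<^sup>2 \<le> (sinh (k * v))\<^sup>2"
    using \<open>2 \<le> k\<close> by (intro power_mono) auto
  moreover have "cosh w - 1 = 2 * (sinh v)\<^sup>2" "cosh (k * w) = 1 + 2 * (sinh (k * v))\<^sup>2"
    unfolding w cosh_double cosh_square_eq by simp_all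
  ultimately show ?thesis by (simp add: power_mult_distrib)
qed

text \<open>This absorbs the shift of the mean: \<open>2 * s \<le> 1 + s\<^sup>2\<close>, with
  \<open>s\<^sup>2\<close> controlled by the preceding lemma for \<open>k = 1 / \<gamma>\<close>.
  The bound on \<open>\<gamma>\<close> ensures \<open>2 \<le> k\<close>.\<close>

lemma cosh_defect_le:
  fixes \<gamma> w y :: real
  assumes "0 < \<gamma>" "\<gamma> \<le> 1 / 2"
  shows "2 * y * cosh w - 2 * \<gamma> * y\<^sup>2 * cosh (w / \<gamma>) \<le> \<gamma> + 2 * y"
proof -
  define s where "s = y * (1 / \<gamma> * (cosh w - 1))"
  have "2 \<le> 1 / \<gamma>" using assms by (simp add: field_simps)
  from cosh_minus_one_square_le[OF this, of w]
  have "s\<^sup>2 \<le> y\<^sup>2 * (2 * cosh (w / \<gamma>))"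
    unfolding s_def power_mult_distrib[of y] by (intro mult_left_mono) auto
  moreover have "2 * s \<le> 1 + s\<^sup>2"
    using zero_le_power2[of "s - 1"] by (simp add: power2_diff)
  ultimately have "\<gamma> * (2 * s) \<le> \<gamma> * (1 + y\<^sup>2 * (2 * cosh (w / \<gamma>)))"
    using assms by (intro mult_left_mono) auto
  moreover have "\<gamma> * (2 * s) = 2 * y * (cosh w - 1)"
    using assms by (simp add: s_def)
  ultimately show ?thesis by (simp add: algebra_simps)
qed

text \<open>Convexity of \<open>cosh\<close>, from \<open>1 + r \<le> exp r\<close> at
  \<open>r = x - s\<close> and at \<open>r = s - x\<close>; it later plays the part of Jensen's
  inequality.\<close>

lemma cosh_ge_tangent:
  fixes s x :: real
  shows "cosh s + sinh s * (x - s) \<le> cosh x"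
proof -
  have "exp s * (1 + (x - s)) + exp (- s) * (1 - (x - s)) \<le> exp s * exp (x - s) + exp (- s) * exp (- (x - s))"
    using exp_ge_add_one_self[of "x - s"] exp_ge_add_one_self[of "- (x - s)"]
    by (intro add_mono mult_left_mono) (simp_all del: exp_ge_add_one_self)
  also have "\<dots> = exp x + exp (- x)"
    by (simp flip: exp_add)
  finally show ?thesis
    by (simp add: cosh_def sinh_def field_simps)
qed

section \<open>Concentration on a subset of a product space\<close>

lemma (in product_prob_space) bounded_differences_on_subset:
  fixes F :: "('i \<Rightarrow> 'a) \<Rightarrow> real" and c :: "'i \<Rightarrow> real" and \<epsilon> :: real
  assumes "finite J" and \<Xi> [measurable]: "\<Xi> \<in> sets (PiM J M)"
    and pos: "0 < measure (PiM J M) \<Xi>"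
    and F [measurable]: "F \<in> borel_measurable (PiM J M)"
    and c: "\<And>i. i \<in> J \<Longrightarrow> 0 \<le> c i"
    and diff: "\<And>z y. z \<in> \<Xi> \<Longrightarrow> y \<in> \<Xi> \<Longrightarrow> F z \<le> F y + sum c {j\<in>J. z j \<noteq> y j}"
    and "0 \<le> \<epsilon>"
  defines "\<gamma> \<equiv> 1 - measure (PiM J M) \<Xi>"
    and "m \<equiv> (\<integral>z. indicator \<Xi> z * F z \<partial>PiM J M) / measure (PiM J M) \<Xi>"
  shows "measure (PiM J M) {z\<in>\<Xi>. \<epsilon> < \<bar>F z - m\<bar>} \<le> \<gamma> + 2 * exp (- 2 * \<epsilon>\<^sup>2 / (\<Sum>i\<in>J. (c i)\<^sup>2))"
proof -
  interpret N: prob_space "PiM J M"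
    by (rule prob_space_PiM) (rule prob_space)
  define V where "V = (\<Sum>i\<in>J. (c i)\<^sup>2)"
  define A where "A = {z\<in>\<Xi>. \<epsilon> < \<bar>F z - m\<bar>}"
  have "A = {z\<in>space (PiM J M). z \<in> \<Xi> \<and> \<epsilon> < \<bar>F z - m\<bar>}"
    using sets.sets_into_space[OF \<Xi>] by (auto simp: A_def)
  then have A [measurable]: "A \<in> sets (PiM J M)" by simp
  have "0 \<le> V" by (auto simp: V_def intro: sum_nonneg)
  have "0 \<le> \<gamma>" by (simp add: \<gamma>_def)
  \<comment> \<open>Two cases are trivial: for \<open>V = 0\<close> the quotient is 0 by convention
    and the bound is at least 2; for \<open>1 / 2 < \<gamma>\<close> already \<open>\<Xi>\<close>
    has probability \<open>1 - \<gamma> < \<gamma>\<close>.\<close>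
  consider "V = 0" | "1 / 2 < \<gamma>" | "0 < V" "\<gamma> \<le> 1 / 2"
    using \<open>0 \<le> V\<close> by linarith
  then have "N.prob A \<le> \<gamma> + 2 * exp (- 2 * \<epsilon>\<^sup>2 / V)"
  proof cases
    case 1
    then show ?thesis using \<open>0 \<le> \<gamma>\<close> by simp (use N.prob_le_1[of A] in linarith)
  next
    case 2
    have "N.prob A \<le> N.prob \<Xi>"
      by (intro N.finite_measure_mono) (auto simp: A_def)
    then show ?thesis
      using 2 exp_ge_zero[of "- 2 * \<epsilon>\<^sup>2 / V"] unfolding \<gamma>_def by linarith
  next
    case 3
    have "\<Xi> \<noteq> {}" using pos by auto
    then obtain u B where u [measurable]: "u \<in> borel_measurable (PiM J M)"
      and u_bound: "\<And>z. z \<in> space (PiM J M) \<Longrightarrow> \<bar>u z\<bar> \<le> B"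
      and u_\<Xi>: "\<And>z. z \<in> \<Xi> \<Longrightarrow> u z = F z"
      and u_diff: "\<And>i. i \<in> J \<Longrightarrow> AE z in PiM J M. AE t in M i. u z \<le> u (z(i := t)) + c i"
      using AE_bounded_differences_extension[OF \<open>finite J\<close> \<Xi> _ F c diff] by blast
    define K where "K = space (PiM J M) - \<Xi>"
    have K [measurable]: "K \<in> sets (PiM J M)" by (simp add: K_def)
    have prob_K: "N.prob K = \<gamma>" by (simp add: K_def \<gamma>_def N.prob_compl)
    have bounded_int: "integrable (PiM J M) (\<lambda>z. g (u z))"
      if "continuous_on UNIV g" for g :: "real \<Rightarrow> real"
    proof -
      have "compact (g ` {- B..B})"
        using that by (intro compact_continuous_image) (auto intro: continuous_on_subset)
      then obtain b where b: "\<forall>x\<in>{- B..B}. \<bar>g x\<bar> \<le> b"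
        by (auto dest!: compact_imp_bounded simp: bounded_iff)
      have [measurable]: "g \<in> borel_measurable borel"
        using that by (rule borel_measurable_continuous_onI)
      show ?thesis
        using u_bound b by (intro N.integrable_const_bound[where B=b]) (auto simp: abs_le_iff minus_le_iff)
    qed
    note mult_ind = integrable_real_mult_indicator[where M="PiM J M"]
    have split: "N.expectation g = N.expectation (\<lambda>z. indicator \<Xi> z * g z) + N.expectation (\<lambda>z. indicator K z * g z)"
      if "integrable (PiM J M) g" for g :: "('i \<Rightarrow> 'a) \<Rightarrow> real"
    proof -
      have "N.expectation g = N.expectation (\<lambda>z. indicator \<Xi> z * g z + indicator K z * g z)"
        by (intro Bochner_Integration.integral_cong) (auto simp: K_def indicator_def)
      also have "\<dots> = N.expectation (\<lambda>z. indicator \<Xi> z * g z) + N.expectation (\<lambda>z. indicator K z * g z)"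
        using mult_ind[OF \<Xi> that] mult_ind[OF K that]
        by (intro Bochner_Integration.integral_add) (auto simp: mult.commute)
      finally show ?thesis .
    qed
    \<comment> \<open>The minimiser of \<open>l\<^sup>2 * V / 8 - l * \<epsilon>\<close>; the
      minimum is \<open>- 2 * \<epsilon>\<^sup>2 / V\<close>, the exponent in
      \<open>y\<close>.\<close>
    define l where "l = 4 * \<epsilon> / V"
    define y where "y = exp (- 2 * \<epsilon>\<^sup>2 / V)"
    have "0 < y" by (simp add: y_def)
    have l_V: "l\<^sup>2 * V / 8 = 2 * \<epsilon>\<^sup>2 / V" "l * \<epsilon> = 4 * \<epsilon>\<^sup>2 / V"
      using \<open>0 < V\<close> by (simp_all add: l_def power2_eq_square field_simps)
    have "y * y * exp (l * \<epsilon>) = 1"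
      unfolding y_def l_V by (simp add: exp_add[symmetric])
    define \<mu> where "\<mu> = N.expectation u"
    define \<delta> where "\<delta> = \<mu> - m"
    have exp_int: "integrable (PiM J M) (\<lambda>z. exp (r * (u z - \<mu>)))" for r
      by (intro bounded_int continuous_intros)
    have exp_int: "integrable (PiM J M) (\<lambda>z. exp (r * (u z - \<mu>)))" for r
      by (intro bounded_int continuous_intros)
    have exp_int: "integrable (PiM J M) (\<lambda>z. exp (r * (u z - \<mu>)))" for r
      by (intro bounded_int continuous_intros)
    have exp_int: "integrable (PiM J M) (\<lambda>z. exp (r * (u z - \<mu>)))" for r
      by (intro bounded_int continuous_intros)
    have mgf: "N.expectation (\<lambda>z. exp (r * (u z - \<mu>))) \<le> 1 / y" if "r\<^sup>2 = l\<^sup>2" for r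
    proof -
      have "ennreal (N.expectation (\<lambda>z. exp (r * (u z - \<mu>)))) = (\<integral>\<^sup>+z. exp (r * (u z - \<mu>)) \<partial>PiM J M)"
        by (intro nn_integral_eq_integral[symmetric] exp_int) auto
      also have "\<dots> \<le> exp (r\<^sup>2 * V / 8)"
        unfolding \<mu>_def V_def
        by (rule mgf_le_of_AE_bounded_differences[OF \<open>finite J\<close> u u_bound u_diff])
      also have "exp (r\<^sup>2 * V / 8) = 1 / y"
        unfolding that l_V by (simp add: y_def exp_minus field_simps)
      finally show ?thesis using \<open>0 < y\<close> by simp
    qed
    have cosh_int: "integrable (PiM J M) (\<lambda>z. cosh (l * (u z - m)))"
      by (intro bounded_int continuous_intros)
    \<comment> \<open>Recentring from \<open>m\<close> to \<open>\<mu>\<close> turns the two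
      exponentials in \<open>cosh\<close> into multiples by \<open>exp (l * \<delta>)\<close> and
      \<open>exp (- l * \<delta>)\<close>; \<open>mgf\<close> covers both signs.\<close>
    have upper: "N.expectation (\<lambda>z. cosh (l * (u z - m))) \<le> cosh (l * \<delta>) / y"
    proof -
      have "cosh (l * (u z - m))
          = exp (l * \<delta>) / 2 * exp (l * (u z - \<mu>)) + exp (- l * \<delta>) / 2 * exp (- l * (u z - \<mu>))" for z
        by (simp add: cosh_def \<delta>_def exp_add[symmetric] algebra_simps)
      then have "N.expectation (\<lambda>z. cosh (l * (u z - m)))
          = exp (l * \<delta>) / 2 * N.expectation (\<lambda>z. exp (l * (u z - \<mu>)))
            + exp (- l * \<delta>) / 2 * N.expectation (\<lambda>z. exp (- l * (u z - \<mu>)))"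
        using exp_int[of l] exp_int[of "- l"] by simp
      also have "\<dots> \<le> exp (l * \<delta>) / 2 * (1 / y) + exp (- l * \<delta>) / 2 * (1 / y)"
        by (intro add_mono mult_left_mono mgf) auto
      also have "\<dots> = cosh (l * \<delta>) / y"
        by (simp add: cosh_def add_divide_distrib)
      finally show ?thesis .
    qed
    have "N.expectation (\<lambda>z. indicator \<Xi> z * (u z - m)) = N.expectation (\<lambda>z. indicator \<Xi> z * F z - indicator \<Xi> z * m)"
      by (intro Bochner_Integration.integral_cong) (auto simp: u_\<Xi> indicator_def)
    also have "\<dots> = N.expectation (\<lambda>z. indicator \<Xi> z * F z) - N.prob \<Xi> * m"
    proof -
      \<comment> \<open>\<open>F\<close> is only known to be measurable; its integrability over
        \<open>\<Xi>\<close> comes from the bounded \<open>u\<close>.\<close>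
      have "integrable (PiM J M) (\<lambda>z. indicator \<Xi> z * u z)"
        using mult_ind[OF \<Xi> bounded_int[of "\<lambda>x. x"]] by (simp add: mult.commute)
      then have "integrable (PiM J M) (\<lambda>z. indicator \<Xi> z * F z)"
        by (rule Bochner_Integration.integrable_cong[THEN iffD1, rotated -1]) (auto simp: u_\<Xi> indicator_def)
      then show ?thesis
        by (subst Bochner_Integration.integral_diff) (auto simp: N.emeasure_eq_measure)
    qed
    also have "\<dots> = 0" using pos by (simp add: m_def)
    finally have mean_K: "N.expectation (\<lambda>z. indicator K z * (u z - m)) = \<delta>"
      using split[OF bounded_int[of "\<lambda>x. x - m"]] bounded_int[of "\<lambda>x. x"]
      by (simp add: \<delta>_def \<mu>_def continuous_intros N.prob_space)
    \<comment> \<open>This makes the convention \<open>\<delta> / 0 = 0\<close> harmless.\<close>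
    have \<delta>_0: "\<delta> = 0" if "\<gamma> = 0"
    proof -
      have "AE z in PiM J M. z \<notin> K"
        using that prob_K by (subst AE_iff_measurable[OF K]) (auto simp: N.emeasure_eq_measure K_def)
      then have "N.expectation (\<lambda>z. indicator K z * (u z - m)) = N.expectation (\<lambda>z. 0)"
        by (intro integral_cong_AE) (auto simp: indicator_def)
      then show ?thesis using mean_K by simp
    qed
    have lower: "\<gamma> * cosh (l * \<delta> / \<gamma>) \<le> N.expectation (\<lambda>z. indicator K z * cosh (l * (u z - m)))"
    proof -
      \<comment> \<open>For \<open>\<gamma> > 0\<close> this is the mean of
        \<open>l * (u - m)\<close> conditioned on \<open>K\<close>, so the tangent of
        \<open>cosh\<close> at \<open>s\<close> integrates over \<open>K\<close> to exactly
        \<open>\<gamma> * cosh s\<close>.\<close>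
      define s where "s = l * \<delta> / \<gamma>"
      have "s * \<gamma> = l * \<delta>" using \<delta>_0 by (cases "\<gamma> = 0") (auto simp: s_def)
      have int: "integrable (PiM J M) (\<lambda>z. indicator K z * (u z - m))"
        using mult_ind[OF K bounded_int[of "\<lambda>x. x - m"]] by (simp add: mult.commute continuous_intros)
      have "\<gamma> * cosh s = (cosh s - sinh s * s) * \<gamma> + sinh s * l * \<delta>"
        using \<open>s * \<gamma> = l * \<delta>\<close> by (simp add: algebra_simps)
      also have "\<dots> = N.expectation (\<lambda>z. (cosh s - sinh s * s) * indicator K z + sinh s * l * (indicator K z * (u z - m)))"
        using int by (simp add: mean_K prob_K N.emeasure_eq_measure)
      also have "\<dots> \<le> N.expectation (\<lambda>z. indicator K z * cosh (l * (u z - m)))"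
      proof (rule integral_mono)
        show "integrable (PiM J M) (\<lambda>z. (cosh s - sinh s * s) * indicator K z + sinh s * l * (indicator K z * (u z - m)))"
          using int by (simp add: N.emeasure_eq_measure)
        show "integrable (PiM J M) (\<lambda>z. indicator K z * cosh (l * (u z - m)))"
          using mult_ind[OF K cosh_int] by (simp add: mult.commute)
        show "(cosh s - sinh s * s) * indicator K z + sinh s * l * (indicator K z * (u z - m))
            \<le> indicator K z * cosh (l * (u z - m))" for z
          using cosh_ge_tangent[of s "l * (u z - m)"] by (auto simp: indicator_def algebra_simps)
      qed
      finally show ?thesis by (simp add: s_def)
    qed
    have "N.prob A * (exp (l * \<epsilon>) / 2) = N.expectation (\<lambda>z. indicator A z * (exp (l * \<epsilon>) / 2))"
      by simp
    also have "\<dots> \<le> N.expectation (\<lambda>z. indicator \<Xi> z * cosh (l * (u z - m)))"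
    proof (rule integral_mono)
      show "integrable (PiM J M) (\<lambda>z. indicator A z * (exp (l * \<epsilon>) / 2))"
        by (simp add: N.emeasure_eq_measure)
      show "integrable (PiM J M) (\<lambda>z. indicator \<Xi> z * cosh (l * (u z - m)))"
        using mult_ind[OF \<Xi> cosh_int] by (simp add: mult.commute)
      fix z
      have "exp (l * \<epsilon>) / 2 \<le> cosh (l * (u z - m))" if "z \<in> A"
      proof -
        have "l * \<epsilon> \<le> \<bar>l * (u z - m)\<bar>"
          using that u_\<Xi>[of z] \<open>0 \<le> \<epsilon>\<close> \<open>0 < V\<close>
          by (auto simp: A_def l_def abs_mult intro!: divide_right_mono mult_left_mono)
        then have "exp (l * \<epsilon>) \<le> exp \<bar>l * (u z - m)\<bar>" by simp
        also have "\<dots> \<le> exp (l * (u z - m)) + exp (- (l * (u z - m)))"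
          by (simp add: abs_if)
        finally show ?thesis by (simp add: cosh_def)
      qed
      then show "indicator A z * (exp (l * \<epsilon>) / 2) \<le> indicator \<Xi> z * cosh (l * (u z - m))"
        by (auto simp: indicator_def A_def)
    qed
    also have "\<dots> \<le> cosh (l * \<delta>) / y - \<gamma> * cosh (l * \<delta> / \<gamma>)"
      using upper lower split[OF cosh_int] by linarith
    \<comment> \<open>The factor normalises the left side to the probability of \<open>A\<close> and
      brings the right side into the form of \<open>cosh_defect_le\<close>.\<close>
    finally have "2 * (y * y) * (N.prob A * (exp (l * \<epsilon>) / 2))
        \<le> 2 * (y * y) * (cosh (l * \<delta>) / y - \<gamma> * cosh (l * \<delta> / \<gamma>))"
      using \<open>0 < y\<close> by (intro mult_left_mono) auto
    also have "2 * (y * y) * (N.prob A * (exp (l * \<epsilon>) / 2)) = N.prob A * (y * y * exp (l * \<epsilon>))"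
      by simp
    also have "\<dots> = N.prob A"
      unfolding \<open>y * y * exp (l * \<epsilon>) = 1\<close> by simp
    also have "2 * (y * y) * (cosh (l * \<delta>) / y - \<gamma> * cosh (l * \<delta> / \<gamma>))
        = 2 * y * cosh (l * \<delta>) - 2 * \<gamma> * y\<^sup>2 * cosh (l * \<delta> / \<gamma>)"
      using \<open>0 < y\<close> by (simp add: field_simps power2_eq_square)
    also have "\<dots> \<le> \<gamma> + 2 * y"
    proof (cases "\<gamma> = 0")
      case True
      then show ?thesis using \<delta>_0 by simp
    next
      case False
      then show ?thesis
        using \<open>0 \<le> \<gamma>\<close> \<open>\<gamma> \<le> 1 / 2\<close> by (intro cosh_defect_le) auto
    qed
    finally show ?thesis by (simp add: y_def)
  qed
  then show ?thesis by (simp add: A_def V_def)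
qed

section \<open>The cross-validation score\<close>

text \<open>Let \<open>k\<close> samples differ. An index with a changed sample adds at most
  \<open>C1\<^sup>2\<close> to the sum. At the others the node is the same, and
  \<open>a\<^sup>2 - b\<^sup>2 = (a - b) * (a + b)\<close> gives at most
  \<open>C2 * k * (2 * C1)\<close>.\<close>

lemma cv_score_bounded_differences:
  assumes adm: "admissible_samples \<Omega> Y R f n h C1 C2 \<Xi>"
    and "1 \<le> n" "0 < C1" "0 < C2" and z: "z \<in> \<Xi>" and y: "y \<in> \<Xi>"
  shows "cv_score R f n z h
    \<le> cv_score R f n y h + (C1\<^sup>2 / real n + 2 * C1 * C2) * real (card {j. j < n \<and> z j \<noteq> y j})"
proof -
  define k where "k = real (card {j. j < n \<and> z j \<noteq> y j})"
  define e where "e w i = cmod (R h (leave_out n w i) (fst (w i)) - f (fst (w i)))" for w i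
  have node: "fst (w i) \<in> \<Omega>" if "w \<in> \<Xi>" "i < n" for w i
    using adm that by (force simp: admissible_samples_def PiE_iff)
  have e_less: "e w i < C1" if "w \<in> \<Xi>" "i < n" for w i
  proof -
    have "ereal (e w i) \<le> sup_norm_on \<Omega> (\<lambda>x. R h (leave_out n w i) x - f x)"
      unfolding sup_norm_on_def e_def using node[OF that] by (intro SUP_upper)
    also have "\<dots> < ereal C1"
      using adm that by (auto simp: admissible_samples_def)
    finally show ?thesis by simp
  qed
  have e_nonneg: "0 \<le> e w i" for w i by (simp add: e_def)
  have "(e z i)\<^sup>2 \<le> (e y i)\<^sup>2 + (2 * C1 * C2 * k + (if z i \<noteq> y i then C1\<^sup>2 else 0))" if i: "i < n" for i
  proof (cases "z i = y i")
    case True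
    have "e z i - e y i \<le> cmod (R h (leave_out n z i) (fst (z i)) - R h (leave_out n y i) (fst (z i)))"
      unfolding e_def True[symmetric] by (rule order_trans[OF norm_triangle_ineq2]) simp
    also have "\<dots> \<le> C2 * real (card {j. j < n \<and> j \<noteq> i \<and> z j \<noteq> y j})"
      using adm z y i node[OF z i] by (simp add: admissible_samples_def)
    also have "\<dots> \<le> C2 * k"
      unfolding k_def using \<open>0 < C2\<close> by (auto intro!: mult_left_mono card_mono)
    finally have "e z i - e y i \<le> C2 * k" .
    then have "(e z i - e y i) * (e z i + e y i) \<le> (C2 * k) * (2 * C1)"
      using e_less[OF z i] e_less[OF y i] e_nonneg[of z i] e_nonneg[of y i] \<open>0 < C2\<close>
      by (intro mult_mono) (auto simp: k_def)
    then show ?thesis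
      using True by (simp add: power2_eq_square algebra_simps)
  next
    case False
    have "(e z i)\<^sup>2 \<le> C1\<^sup>2"
      using e_less[OF z i] e_nonneg[of z i] by (intro power_mono) auto
    moreover have "0 \<le> 2 * C1 * C2 * k"
      using \<open>0 < C1\<close> \<open>0 < C2\<close> by (simp add: k_def)
    ultimately show ?thesis
      using False zero_le_power2[of "e y i"] by (simp only: if_True simp_thms)
  qed
  then have "(\<Sum>i<n. (e z i)\<^sup>2)
      \<le> (\<Sum>i<n. (e y i)\<^sup>2 + (2 * C1 * C2 * k + (if z i \<noteq> y i then C1\<^sup>2 else 0)))"
    by (intro sum_mono) auto
  also have "\<dots> = (\<Sum>i<n. (e y i)\<^sup>2) + real n * (2 * C1 * C2 * k) + k * C1\<^sup>2"
    by (simp add: sum.distrib k_def sum.If_cases Int_def conj_commute)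
  finally have "1 / real n * (\<Sum>i<n. (e z i)\<^sup>2)
      \<le> 1 / real n * ((\<Sum>i<n. (e y i)\<^sup>2) + real n * (2 * C1 * C2 * k) + k * C1\<^sup>2)"
    by (intro mult_left_mono) auto
  also have "\<dots> = 1 / real n * (\<Sum>i<n. (e y i)\<^sup>2) + (C1\<^sup>2 / real n + 2 * C1 * C2) * k"
    using \<open>1 \<le> n\<close> by (simp add: field_simps)
  finally show ?thesis by (simp add: cv_score_def e_def k_def)
qed

text \<open>The estimate is transferred to the product space of node vectors. The two bounds are
  compared only beyond \<open>sqrt (2 * real n) * \<gamma>\<close>, where the squared difference
  increases in its first term.\<close>

theorem theorem3p6:
  fixes \<rho> :: "'a measure" and P :: "'w measure"
    and Y :: "complex set" and f :: "'a \<Rightarrow> complex"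
    and R :: "('h, 'a) reconstruction" and h :: 'h
    and n :: nat and X :: "nat \<Rightarrow> 'w \<Rightarrow> 'a"
    and C1 C2 \<gamma> m \<epsilon> :: real and \<Xi> :: "(nat \<Rightarrow> 'a sample) set"
  assumes "prob_space \<rho>" and "prob_space P"
    and "n \<ge> 1"
    and "f \<in> measurable \<rho> (restrict_space borel Y)"
    and "\<forall>s. length s = n - 1 \<and> set s \<subseteq> space \<rho> \<times> Y \<longrightarrow> R h s \<in> space \<rho> \<rightarrow> Y"
    and "(\<lambda>z. cv_score R f n z h)
           \<in> borel_measurable (PiM {..<n} (\<lambda>_. \<rho> \<Otimes>\<^sub>M restrict_space borel Y))"
    and "prob_space.indep_vars P (\<lambda>_. \<rho>) X {..<n}"
    and "\<forall>i<n. distr P \<rho> (X i) = \<rho>"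
    and "0 < C1" and "0 < C2" and "C2 \<le> 2 * C1"
    and "admissible_samples (space \<rho>) Y R f n h C1 C2 \<Xi>"
    and "\<Xi> \<in> sets (PiM {..<n} (\<lambda>_. \<rho> \<Otimes>\<^sub>M restrict_space borel Y))"
    and "measure P {\<omega> \<in> space P. samples n X f \<omega> \<in> \<Xi>} > 0"
    and "\<gamma> = 1 - measure P {\<omega> \<in> space P. samples n X f \<omega> \<in> \<Xi>}"
    and "m = cond_exp_event P (\<lambda>\<omega>. cv_score R f n (samples n X f \<omega>) h)
               {\<omega> \<in> space P. samples n X f \<omega> \<in> \<Xi>}"
    and "\<epsilon> > 2 * \<gamma> * real n * C1 * C2 + \<gamma> * C1\<^sup>2"
  shows
    "let p = measure P {\<omega> \<in> space P. \<bar>cv_score R f n (samples n X f \<omega>) h - m\<bar> > \<epsilon>};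
         bound1 = 2 * \<gamma> + 2 * exp (- ((sqrt 2 * \<epsilon> / (C1 * (C1 / sqrt (real n) + 2 * sqrt (real n) * C2))
                                       - sqrt (2 * real n) * \<gamma>)\<^sup>2));
         bound2 = 2 * \<gamma> + 2 * exp (- ((\<epsilon> / (3 * sqrt (real n) * C1\<^sup>2) - sqrt (2 * real n) * \<gamma>)\<^sup>2))
     in p \<le> bound1
        \<and> (n \<ge> 5 \<longrightarrow> p \<le> bound2)
        \<and> (n \<ge> 5 \<and> sqrt (2 * real n) * \<gamma> \<le> \<epsilon> / (3 * sqrt (real n) * C1\<^sup>2) \<longrightarrow> bound1 \<le> bound2)"
proof -
  interpret rho: prob_space \<rho> by fact
  interpret P: prob_space P by fact
  interpret prod: product_prob_space "\<lambda>_. \<rho>" "{..<n}" ..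
  define N where "N = PiM {..<n} (\<lambda>_. \<rho>)"
  define S where "S = PiM {..<n} (\<lambda>_. \<rho> \<Otimes>\<^sub>M restrict_space borel Y)"
  interpret N: prob_space N
    unfolding N_def by (rule prob_space_PiM) (rule assms)
  \<comment> \<open>\<open>samples\<close> factors as \<open>Z\<close> after \<open>T\<close>:
    \<open>T\<close> collects the random nodes and \<open>Z\<close> attaches the values of
    \<open>f\<close>, so everything depends on the nodes alone.\<close>
  define Z where "Z x = (\<lambda>i\<in>{..<n}. (x i, f (x i)))" for x :: "nat \<Rightarrow> 'a"
  define T where "T \<omega> = (\<lambda>i\<in>{..<n}. X i \<omega>)" for \<omega>
  define F where "F x = cv_score R f n (Z x) h" for x
  define \<Xi>' where "\<Xi>' = Z -` \<Xi> \<inter> space N"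
  have Z [measurable]: "Z \<in> N \<rightarrow>\<^sub>M S"
    unfolding Z_def N_def S_def
  proof (rule measurable_restrict)
    fix i assume "i \<in> {..<n}"
    then have "(\<lambda>x. x i) \<in> PiM {..<n} (\<lambda>_. \<rho>) \<rightarrow>\<^sub>M \<rho>"
      by (rule measurable_component_singleton)
    then show "(\<lambda>x. (x i, f (x i))) \<in> PiM {..<n} (\<lambda>_. \<rho>) \<rightarrow>\<^sub>M \<rho> \<Otimes>\<^sub>M restrict_space borel Y"
      using measurable_compose[OF _ assms(4)] by (intro measurable_Pair) auto
  qed
  have F [measurable]: "F \<in> borel_measurable N"
    unfolding F_def using measurable_compose[OF Z, unfolded S_def, OF assms(6)] .
  have \<Xi>' [measurable]: "\<Xi>' \<in> sets N"
    unfolding \<Xi>'_def using Z assms(13) by (auto simp: S_def intro: measurable_sets)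
  have X: "X i \<in> P \<rightarrow>\<^sub>M \<rho>" if "i < n" for i
    using assms(7) that by (auto simp: P.indep_vars_def)
  have T [measurable]: "T \<in> P \<rightarrow>\<^sub>M N"
    unfolding T_def N_def using X by (intro measurable_restrict) auto
  have "{..<n} \<noteq> {}" using assms(3) by (auto simp: lessThan_empty_iff)
  then have "distr P N T = (\<Pi>\<^sub>M i\<in>{..<n}. distr P \<rho> (X i))"
    unfolding N_def T_def using P.indep_vars_iff_distr_eq_PiM'[where I="{..<n}" and M'="\<lambda>_. \<rho>" and X=X] X assms(3,7)
    by auto
  also have "\<dots> = N"
    unfolding N_def using assms(8) by (intro PiM_cong) auto
  finally have distr_T: "distr P N T = N" .
  have samples: "samples n X f \<omega> = Z (T \<omega>)" for \<omega>
    by (auto simp: samples_def Z_def T_def)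
  have measure_T: "measure P {\<omega>\<in>space P. Q (T \<omega>)} = measure N {x\<in>space N. Q x}"
    if "{x\<in>space N. Q x} \<in> sets N" for Q
    unfolding distr_T[symmetric, THEN arg_cong, of measure]
    using that measurable_space[OF T]
    by (subst measure_distr[OF T]) (auto intro!: arg_cong[where f="measure P"])
  have "{x\<in>space N. Z x \<in> \<Xi>} = \<Xi>'" by (auto simp: \<Xi>'_def)
  then have prob_\<Xi>: "measure P {\<omega>\<in>space P. samples n X f \<omega> \<in> \<Xi>} = measure N \<Xi>'"
    using measure_T[of "\<lambda>x. Z x \<in> \<Xi>"] by (simp add: samples)
  have \<gamma>: "\<gamma> = 1 - measure N \<Xi>'" "0 \<le> \<gamma>"
    using assms(15) by (simp_all add: prob_\<Xi>)
  have "(LINT \<omega>|P. indicator {\<omega>\<in>space P. samples n X f \<omega> \<in> \<Xi>} \<omega> * F (T \<omega>))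
      = (LINT \<omega>|P. indicator \<Xi>' (T \<omega>) * F (T \<omega>))"
    using measurable_space[OF T]
    by (intro Bochner_Integration.integral_cong) (auto simp: indicator_def \<Xi>'_def samples)
  also have "\<dots> = (LINT x|distr P N T. indicator \<Xi>' x * F x)"
    by (intro integral_distr[symmetric]) measurable
  finally have m: "m = (LINT x|N. indicator \<Xi>' x * F x) / measure N \<Xi>'"
    using assms(16) unfolding cond_exp_event_def prob_\<Xi> by (simp add: distr_T F_def samples)
  define c where "c = C1\<^sup>2 / real n + 2 * C1 * C2"
  have "0 < c" using assms(3,9,10) by (auto simp: c_def intro!: add_nonneg_pos)
  have diff: "F x \<le> F y + sum (\<lambda>_. c) {j\<in>{..<n}. x j \<noteq> y j}" if "x \<in> \<Xi>'" "y \<in> \<Xi>'" for x y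
  proof -
    have "F x \<le> F y + c * real (card {j. j < n \<and> Z x j \<noteq> Z y j})"
      using cv_score_bounded_differences[OF assms(12,3,9,10)] that
      by (simp add: \<Xi>'_def F_def c_def)
    \<comment> \<open>Each value is a function of its node, so samples differ only where nodes
      differ.\<close>
    also have "\<dots> \<le> F y + c * real (card {j\<in>{..<n}. x j \<noteq> y j})"
      using \<open>0 < c\<close> by (auto intro!: mult_left_mono card_mono simp: Z_def)
    finally show ?thesis by (simp add: mult.commute)
  qed
  have "0 \<le> 2 * \<gamma> * real n * C1 * C2 + \<gamma> * C1\<^sup>2"
    using \<gamma>(2) assms(9,10) by simp
  then have "0 < \<epsilon>" using assms(17) by linarith
  have "measure N {x\<in>\<Xi>'. \<epsilon> < \<bar>F x - m\<bar>} \<le> \<gamma> + 2 * exp (- 2 * \<epsilon>\<^sup>2 / (\<Sum>i\<in>{..<n}. c\<^sup>2))"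
    unfolding \<gamma>(1) m N_def
    using assms(14) \<open>0 < c\<close> \<open>0 < \<epsilon>\<close> \<Xi>' F diff unfolding prob_\<Xi> N_def
    by (intro prod.bounded_differences_on_subset[where J="{..<n}" and c="\<lambda>_. c"]) auto
  then have good: "measure N {x\<in>\<Xi>'. \<epsilon> < \<bar>F x - m\<bar>} \<le> \<gamma> + 2 * exp (- 2 * \<epsilon>\<^sup>2 / (real n * c\<^sup>2))"
    by simp
  define p where "p = measure P {\<omega> \<in> space P. \<bar>cv_score R f n (samples n X f \<omega>) h - m\<bar> > \<epsilon>}"
  have "{x\<in>\<Xi>'. \<epsilon> < \<bar>F x - m\<bar>} = {x\<in>space N. x \<in> \<Xi>' \<and> \<epsilon> < \<bar>F x - m\<bar>}"
    by (auto simp: \<Xi>'_def)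
  then have good_sets: "{x\<in>\<Xi>'. \<epsilon> < \<bar>F x - m\<bar>} \<in> sets N" by simp
  have "p = measure N {x\<in>space N. \<epsilon> < \<bar>F x - m\<bar>}"
    unfolding p_def using measure_T[of "\<lambda>x. \<epsilon> < \<bar>F x - m\<bar>"] by (simp add: samples F_def[symmetric])
  \<comment> \<open>The complement of \<open>\<Xi>'\<close> costs one more \<open>\<gamma>\<close>,
    which yields \<open>2 * \<gamma>\<close> in total.\<close>
  also have "\<dots> \<le> measure N ((space N - \<Xi>') \<union> {x\<in>\<Xi>'. \<epsilon> < \<bar>F x - m\<bar>})"
    using good_sets by (intro N.finite_measure_mono) auto
  also have "\<dots> \<le> measure N (space N - \<Xi>') + measure N {x\<in>\<Xi>'. \<epsilon> < \<bar>F x - m\<bar>}"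
    using good_sets by (intro measure_Un_le) auto
  also have "measure N (space N - \<Xi>') = \<gamma>"
    by (simp add: N.prob_compl \<gamma>)
  finally have p_le: "p \<le> 2 * \<gamma> + 2 * exp (- 2 * \<epsilon>\<^sup>2 / (real n * c\<^sup>2))"
    using good by linarith
  define t where "t = sqrt 2 * \<epsilon> / (C1 * (C1 / sqrt (real n) + 2 * sqrt (real n) * C2))"
  define t' where "t' = \<epsilon> / (3 * sqrt (real n) * C1\<^sup>2)"
  define G where "G = sqrt (2 * real n) * \<gamma>"
  have n: "0 < sqrt (real n)" "sqrt (real n) * sqrt (real n) = real n" using assms(3) by auto
  have s: "C1 * (C1 / sqrt (real n) + 2 * sqrt (real n) * C2) = sqrt (real n) * c"
    using n by (simp add: c_def field_simps power2_eq_square)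
  have "2 * \<epsilon>\<^sup>2 / (real n * c\<^sup>2) = t\<^sup>2"
    unfolding t_def s using n \<open>0 < c\<close> by (simp add: power_divide power_mult_distrib)
  then have p_t: "p \<le> 2 * \<gamma> + 2 * exp (- t\<^sup>2)"
    using p_le by simp
  have "0 \<le> G" using \<gamma> by (simp add: G_def)
  have "0 \<le> t'" using \<open>0 < \<epsilon>\<close> by (simp add: t'_def)
  \<comment> \<open>This is the lower bound on \<open>\<epsilon>\<close>, which reads
    \<open>\<gamma> * (real n * c) < \<epsilon>\<close>.\<close>
  have "G \<le> t"
  proof -
    have "\<gamma> * (real n * c) = 2 * \<gamma> * real n * C1 * C2 + \<gamma> * C1\<^sup>2"
      using assms(3) by (simp add: c_def field_simps)
    then have "\<gamma> * (real n * c) \<le> \<epsilon>" using assms(17) by linarith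
    have "G * (sqrt (real n) * c) = sqrt 2 * (\<gamma> * (sqrt (real n) * sqrt (real n) * c))"
      by (simp add: G_def real_sqrt_mult)
    also have "\<dots> \<le> sqrt 2 * \<epsilon>"
      unfolding n(2) using \<open>\<gamma> * (real n * c) \<le> \<epsilon>\<close> by simp
    finally show ?thesis
      unfolding t_def s using n \<open>0 < c\<close> by (simp add: pos_le_divide_eq)
  qed
  have t'_le: "t' \<le> t" if "5 \<le> n"
  proof -
    \<comment> \<open>From \<open>5 \<le> n\<close> and \<open>C2 \<le> 2 * C1\<close> the constant
      is \<open>1 / 5 + 4 = 21 / 5\<close>, and \<open>21 / 5 = 3 * (7 / 5)\<close> is below
      \<open>3 * sqrt 2\<close>.\<close>
    have "sqrt (real n) * c \<le> sqrt (real n) * (C1\<^sup>2 / 5 + 4 * C1\<^sup>2)"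
    proof (intro mult_left_mono)
      have "C1\<^sup>2 / real n \<le> C1\<^sup>2 / 5" using that by (intro divide_left_mono) auto
      moreover have "2 * C1 * C2 \<le> 2 * C1 * (2 * C1)"
        using assms(9,11) by (intro mult_left_mono) auto
      ultimately show "c \<le> C1\<^sup>2 / 5 + 4 * C1\<^sup>2" by (simp add: c_def power2_eq_square)
    qed simp
    also have "\<dots> = 21 / 5 * (sqrt (real n) * C1\<^sup>2)" by (simp add: algebra_simps)
    also have "\<dots> \<le> (sqrt 2 * 3) * (sqrt (real n) * C1\<^sup>2)"
    proof (intro mult_right_mono)
      have "7 / 5 \<le> sqrt 2" by (rule real_le_rsqrt) (simp add: power2_eq_square)
      then show "21 / 5 \<le> sqrt 2 * 3" by simp
    qed simp
    finally have "sqrt (real n) * c \<le> sqrt 2 * (3 * sqrt (real n) * C1\<^sup>2)" by simp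
    then have "\<epsilon> * (sqrt (real n) * c) \<le> \<epsilon> * (sqrt 2 * (3 * sqrt (real n) * C1\<^sup>2))"
      using \<open>0 < \<epsilon>\<close> by (intro mult_left_mono) auto
    then show ?thesis
      unfolding t_def t'_def s using n \<open>0 < c\<close> assms(9)
      by (intro frac_le_eq[THEN iffD2]) (auto simp: field_simps)
  qed
  \<comment> \<open>Both \<open>r\<close> and \<open>G\<close> lie in \<open>{0..t}\<close>, so
    their distance is at most \<open>t\<close>, whichever is larger; \<open>r = t\<close> and
    \<open>r = t'\<close> give the two claimed bounds.\<close>
  have bound: "p \<le> 2 * \<gamma> + 2 * exp (- (r - G)\<^sup>2)" if "0 \<le> r" "r \<le> t" for r
  proof -
    have "\<bar>r - G\<bar> \<le> \<bar>t\<bar>" using that \<open>0 \<le> G\<close> \<open>G \<le> t\<close> by linarith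
    then have "(r - G)\<^sup>2 \<le> t\<^sup>2" by (simp only: abs_le_square_iff)
    then have "exp (- t\<^sup>2) \<le> exp (- (r - G)\<^sup>2)" by simp
    then show ?thesis using p_t by linarith
  qed
  have "2 * \<gamma> + 2 * exp (- (t - G)\<^sup>2) \<le> 2 * \<gamma> + 2 * exp (- (t' - G)\<^sup>2)" if "5 \<le> n" "G \<le> t'"
    using that t'_le by (simp add: power_mono)
  then show ?thesis
    using bound[of t] bound[of t'] t'_le \<open>0 \<le> t'\<close> \<open>0 \<le> G\<close> \<open>G \<le> t\<close>
    unfolding Let_def p_def[symmetric] t_def[symmetric] t'_def[symmetric] G_def[symmetric] by auto
qed

end
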